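(* Let $n\geq 3$ and let $P$ be a polynomial of degree $n$ with complex coefficients, each of whose fixed points in $\mathbb{C}$ is simple. If the fixed points of $P$ form the vertices of a regular $n$-gon, then all the multipliers of the fixed points of $P$ are equidistant from $1$, i.e. $|P'(z)-1|$ takes the same value at every fixed point $z$ of $P$. Moreover, the multipliers of the fixed points of $P$ constitute the vertices of a regular $n$-gon centered at $1$.
   Context: A fixed point of a polynomial $P$ means a finite fixed point, i.e. $z_0\in\mathbb{C}$ with $P(z_0)=z_0$; its multiplier is $P'(z_0)$. A fixed point is simple if it is a simple root of $P(z)-z$. A regular $n$-gon centered at $a\in\mathbb{C}$ with radius $r>0$ is the convex polygon with vertices $v_k=a+re^{i(\theta+2\pi k/n)}$, $k=0,1,\dots,n-1$, for some $\theta\in(0,2\pi]$. *)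

theory Defs
  imports Complex_Main "HOL-Computational_Algebra.Polynomial"
begin

definition fixed_points :: "complex poly \<Rightarrow> complex set" where
  "fixed_points P = {z. poly P z = z}"

definition multiplier :: "complex poly \<Rightarrow> complex \<Rightarrow> complex" where
  "multiplier P z = poly (pderiv P) z"

text \<open>
  The polynomial \<open>[:0, 1:]\<close> is the indeterminate, so a fixed point is simple iff it is a root of
  multiplicity one of \<open>P(z) - z\<close>.
\<close>

definition simple_fixed_point :: "complex poly \<Rightarrow> complex \<Rightarrow> bool" where
  "simple_fixed_point P z \<longleftrightarrow> z \<in> fixed_points P \<and> order z (P - [:0, 1:]) = 1"

definition regular_ngon_vertex :: "nat \<Rightarrow> complex \<Rightarrow> real \<Rightarrow> real \<Rightarrow> nat \<Rightarrow> complex" where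
  "regular_ngon_vertex n a r \<theta> k =
     a + of_real r * exp (\<i> * of_real (\<theta> + 2 * pi * real k / real n))"

text \<open>
  The polygon enters only through its set of vertices; for \<open>n \<ge> 1\<close> these are \<open>n\<close> distinct points.
\<close>

definition vertices_of_regular_ngon_centered_at :: "nat \<Rightarrow> complex \<Rightarrow> complex set \<Rightarrow> bool" where
  "vertices_of_regular_ngon_centered_at n a V \<longleftrightarrow>
     (\<exists>r \<theta>. 0 < r \<and> 0 < \<theta> \<and> \<theta> \<le> 2 * pi \<and> V = regular_ngon_vertex n a r \<theta> ` {0..<n})"

definition vertices_of_regular_ngon :: "nat \<Rightarrow> complex set \<Rightarrow> bool" where
  "vertices_of_regular_ngon n V \<longleftrightarrow> (\<exists>a. vertices_of_regular_ngon_centered_at n a V)"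

end

theory Submission
  imports Defs
begin

text \<open>
  The vertices of a regular \<open>n\<close>-gon centered at \<open>a\<close> are the \<open>n\<close> roots of \<open>(z - a)^n = u\<close> for some
  \<open>u \<noteq> 0\<close>. Hence \<open>P(z) - z = c ((z - a)^n - u)\<close>, and a fixed point \<open>z\<close> has multiplier \<open>m\<close> with
  \<open>m - 1 = c n (z - a)^(n-1) = c n u / (z - a)\<close>. The inversion \<open>y \<mapsto> c n u / y\<close> carries the solutions
  of \<open>y^n = u\<close> onto those of \<open>x^n = (c n u)^n / u\<close>.
\<close>

text \<open>Dividing \<open>z - a\<close> by \<open>w\<close> reduces the equation to the
  \<open>n\<close>-th roots of unity. Writing the right-hand side as \<open>w ^ n\<close> makes
  \<open>a + w\<close> the vertex with index 0.\<close>

lemma roots_eq_image_cis: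
  fixes w :: complex
  assumes "0 < n" "w \<noteq> 0"
  shows "{z. (z - a) ^ n = w ^ n} = (\<lambda>k. a + w * cis (2 * pi * real k / real n)) ` {0..<n}"
    (is "?L = _")
proof -
  have U: "{z. z ^ n = 1} = (\<lambda>k. cis (2 * pi * real k / real n)) ` {0..<n}"
    using bij_betw_roots_unity[OF assms(1)] by (auto simp: bij_betw_def atLeast0LessThan)
  have "?L = (\<lambda>x. a + w * x) ` {z. z ^ n = 1}"
  proof (intro equalityI subsetI)
    fix z assume "z \<in> ?L"
    then have "((z - a) / w) ^ n = 1" "z = a + w * ((z - a) / w)"
      using assms(2) by (auto simp: power_divide)
    then show "z \<in> (\<lambda>x. a + w * x) ` {z. z ^ n = 1}" by blast
  qed (auto simp: power_mult_distrib)
  then show ?thesis by (simp add: U image_image)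
qed

lemma regular_ngon_vertex_eq:
  "regular_ngon_vertex n a r \<theta> k = a + rcis r \<theta> * cis (2 * pi * real k / real n)"
  by (simp add: regular_ngon_vertex_def rcis_def cis_conv_exp exp_add distrib_left)

text \<open>Bridges two angle conventions: \<open>Arg\<close> takes values in (-pi, pi], the polygon
  asks for (0, 2 pi]. Nonpositive arguments are moved by a full turn.\<close>

lemma rcis_exists_pos_angle:
  assumes "w \<noteq> 0"
  obtains r \<theta> where "0 < r" "0 < \<theta>" "\<theta> \<le> 2 * pi" "w = rcis r \<theta>"
proof -
  define \<theta> where "\<theta> = (if 0 < Arg w then Arg w else Arg w + 2 * pi)"
  have "w = rcis (cmod w) \<theta>"
    using rcis_cmod_Arg[of w] by (simp add: \<theta>_def rcis_def complex_eq_iff)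
  moreover have "0 < \<theta>" "\<theta> \<le> 2 * pi"
    using Arg_bounded[of w] by (auto simp: \<theta>_def)
  ultimately show thesis using that[of "cmod w" \<theta>] assms by simp
qed

text \<open>Trades radius and angle for the single number \<open>u\<close>, the \<open>n\<close>-th
  power of the offset of any vertex from the center; conversely, any \<open>n\<close>-th root of
  \<open>u\<close> serves as first offset.\<close>

lemma vertices_of_regular_ngon_centered_at_iff_roots:
  assumes "0 < n"
  shows "vertices_of_regular_ngon_centered_at n a V \<longleftrightarrow> (\<exists>u. u \<noteq> 0 \<and> V = {z. (z - a) ^ n = u})"
proof
  assume "vertices_of_regular_ngon_centered_at n a V"
  then obtain r \<theta> where r: "0 < r" and "V = regular_ngon_vertex n a r \<theta> ` {0..<n}"
    by (auto simp: vertices_of_regular_ngon_centered_at_def)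
  then have "V = {z. (z - a) ^ n = rcis r \<theta> ^ n}" "rcis r \<theta> ^ n \<noteq> 0"
    using roots_eq_image_cis[OF assms, of "rcis r \<theta>" a] by (auto simp: regular_ngon_vertex_eq)
  then show "\<exists>u. u \<noteq> 0 \<and> V = {z. (z - a) ^ n = u}" by blast
next
  assume "\<exists>u. u \<noteq> 0 \<and> V = {z. (z - a) ^ n = u}"
  then obtain u where u: "u \<noteq> 0" "V = {z. (z - a) ^ n = u}" by blast
  \<comment> \<open>An \<open>n\<close>-th root of \<open>u\<close> exists because their number
    \<open>n\<close> is positive.\<close>
  have "card {z. z ^ n = u} = n" using card_nth_roots[OF u(1) assms] .
  then have "{z. z ^ n = u} \<noteq> {}" using assms by (metis card.empty less_irrefl)
  then obtain w where w: "w ^ n = u" by blast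
  then have "w \<noteq> 0" using u(1) assms by (auto simp: power_0_left)
  then obtain r \<theta> where "0 < r" "0 < \<theta>" "\<theta> \<le> 2 * pi" "w = rcis r \<theta>"
    by (rule rcis_exists_pos_angle)
  then show "vertices_of_regular_ngon_centered_at n a V"
    using roots_eq_image_cis[OF assms \<open>w \<noteq> 0\<close>, of a] u(2) w
    unfolding vertices_of_regular_ngon_centered_at_def regular_ngon_vertex_eq by blast
qed

lemma card_shifted_roots:
  fixes u :: complex
  assumes "0 < n" "u \<noteq> 0"
  shows "card {z. (z - a) ^ n = u} = n"
proof -
  have "bij_betw (\<lambda>z. z + a) {z. z ^ n = u} {z. (z - a) ^ n = u}"
    by (rule bij_betw_byWitness[where f' = "\<lambda>z. z - a"]) auto
  then show ?thesis using card_nth_roots[OF assms(2,1)] by (simp add: bij_betw_same_card)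
qed

text \<open>In the difference of the two sides the leading terms cancel, so if nonzero it has degree
  below \<open>n\<close>. Yet it vanishes at the roots of \<open>(z - a) ^ n = u\<close>, which are
  \<open>n\<close> distinct points as \<open>u \<noteq> 0\<close>.\<close>

lemma poly_eq_smult_if_roots:
  fixes Q :: "complex poly"
  assumes "0 < n" "u \<noteq> 0" and deg: "degree Q = n"
    and roots: "\<And>z. (z - a) ^ n = u \<Longrightarrow> poly Q z = 0"
  shows "Q = smult (lead_coeff Q) ([:- a, 1:] ^ n - [:u:])"
proof (rule ccontr)
  define S where "S = [:- a, 1:] ^ n - [:u:]"
  define D where "D = Q - smult (lead_coeff Q) S"
  assume "Q \<noteq> smult (lead_coeff Q) ([:- a, 1:] ^ n - [:u:])"
  then have D: "D \<noteq> 0" by (simp add: D_def S_def)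
  have degX: "degree ([:- a, 1:] ^ n) = n" by (simp add: degree_linear_power)
  then have degS: "degree S \<le> n"
    unfolding S_def by (intro degree_diff_le) auto
  \<comment> \<open>The power is monic, and as \<open>n > 0\<close> the constant \<open>u\<close>
    does not touch the coefficient of index \<open>n\<close>.\<close>
  have "coeff S n = 1"
    using degX assms(1) lead_coeff_power[of "[:- a, 1:]" n]
    by (simp add: S_def coeff_pCons split: nat.split)
  then have "coeff D n = 0" using deg by (simp add: D_def)
  moreover have "coeff D k = 0" if "n < k" for k
    using that deg degS by (simp add: D_def coeff_eq_0)
  ultimately have "degree D < n"
    using D by (intro degree_lessI) (auto simp: le_less)
  moreover have "{z. (z - a) ^ n = u} \<subseteq> {z. poly D z = 0}"
    using roots by (auto simp: D_def S_def)
  then have "card {z. (z - a) ^ n = u} \<le> card {z. poly D z = 0}"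
    by (intro card_mono poly_roots_finite D)
  then have "n \<le> degree D"
    using card_poly_roots_bound[OF D] card_shifted_roots[OF assms(1,2), of a] by simp
  ultimately show False by simp
qed

theorem theorem3p3:
  fixes n :: nat and P :: "complex poly"
  assumes "n \<ge> 3"
    and "degree P = n"
    and "\<forall>z \<in> fixed_points P. simple_fixed_point P z"
    and "vertices_of_regular_ngon n (fixed_points P)"
  shows "(\<forall>z \<in> fixed_points P. \<forall>w \<in> fixed_points P.
            cmod (multiplier P z - 1) = cmod (multiplier P w - 1)) \<and>
         vertices_of_regular_ngon_centered_at n 1 (multiplier P ` fixed_points P)"
proof -
  have n: "0 < n" using assms(1) by simp
  obtain a u where u: "u \<noteq> 0" and V: "fixed_points P = {z. (z - a) ^ n = u}"
    using assms(4) vertices_of_regular_ngon_centered_at_iff_roots[OF n]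
    unfolding vertices_of_regular_ngon_def by blast
  define Q where "Q = P - [:0, 1:]"
  define c where "c = lead_coeff Q"
  \<comment> \<open>Subtracting the indeterminate keeps the degree because
    \<open>n > 1\<close>.\<close>
  have degQ: "degree Q = n"
    using assms(1,2) degree_add_eq_left[of "- [:0, 1:]" P]
    by (simp add: Q_def del: minus_pCons)
  have c: "c \<noteq> 0" using degQ n by (auto simp: c_def)
  have "poly Q z = 0" if "(z - a) ^ n = u" for z
    using that V by (auto simp: Q_def fixed_points_def)
  then have Q: "Q = smult c ([:- a, 1:] ^ n - [:u:])"
    unfolding c_def by (intro poly_eq_smult_if_roots[OF n u degQ])
  define b where "b = c * of_nat n * u"
  have b: "b \<noteq> 0" using c n u by (simp add: b_def)
  have mult: "multiplier P z - 1 = b / (z - a)" if "(z - a) ^ n = u" for z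
  proof -
    have za: "z \<noteq> a" using that u n by (auto simp: power_0_left)
    have "P = Q + [:0, 1:]" by (simp add: Q_def)
    then have "multiplier P z - 1 = c * of_nat n * (z - a) ^ (n - 1)"
      by (simp add: multiplier_def Q pderiv_add pderiv_smult pderiv_diff pderiv_power pderiv_pCons)
    also have "\<dots> = b / (z - a)"
      using za that n by (simp add: b_def power_eq_if field_simps)
    finally show "multiplier P z - 1 = b / (z - a)" .
  qed
  have img: "multiplier P ` fixed_points P = {m. (m - 1) ^ n = b ^ n / u}"
  proof (intro equalityI subsetI)
    fix m assume "m \<in> {m. (m - 1) ^ n = b ^ n / u}"
    then have m: "(m - 1) ^ n = b ^ n / u" by simp
    then have m1: "m \<noteq> 1" using b u n by (auto simp: power_0_left)
    \<comment> \<open>The witness solves \<open>m - 1 = b / (z - a)\<close> for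
      \<open>z\<close>.\<close>
    define z where "z = a + b / (m - 1)"
    have z: "(z - a) ^ n = u" using m b u by (simp add: z_def power_divide)
    then have "multiplier P z - 1 = m - 1" using mult[OF z] b m1 by (simp add: z_def)
    then show "m \<in> multiplier P ` fixed_points P" using z V by force
  qed (auto simp: V mult power_divide)
  \<comment> \<open>All the numbers \<open>multiplier P z - 1\<close> have the same
    \<open>n\<close>-th power, so their moduli equal the same real \<open>n\<close>-th root.\<close>
  have cm: "cmod (multiplier P z - 1) = root n (cmod (b ^ n / u))" if "z \<in> fixed_points P" for z
  proof -
    have "(multiplier P z - 1) ^ n = b ^ n / u" using img that by blast
    then have "cmod (multiplier P z - 1) ^ n = cmod (b ^ n / u)" by (metis norm_power)
    then show ?thesis using n by (metis norm_ge_zero real_root_power_cancel)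
  qed
  have "b ^ n / u \<noteq> 0" using b u by simp
  then have "vertices_of_regular_ngon_centered_at n 1 (multiplier P ` fixed_points P)"
    using img vertices_of_regular_ngon_centered_at_iff_roots[OF n] by blast
  then show ?thesis using cm by metis
qed

end
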